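(* Let $\{p(\tau)\}_{\tau\in\mathbb{N}_0}$ be a probability distribution on $\mathbb{N}_0$ and let $\{(X,T)_t\}_{t\ge 0}$ be the trapped random walk with trapping time distribution $p$, started at the origin, i.e. $\mathbb{P}((X,T)_0=(z,\tau))=p(\tau)$ if $z=0$ and $=0$ otherwise. Let $\sigma_t^2:=\mathbb{E}(X_t^2)$. If the trapping time has infinite mean, i.e. $\sum_{\tau\ge 0}\tau\,p(\tau)=\infty$, then $\lim_{t\to\infty}\sigma_t^2/t=0$.
   Context: $\mathbb{N}_0=\{0,1,2,\dots\}$. Trapped random walk with trapping time distribution $p$: the discrete-time Markov chain $(X,T)_t=(X_t,T_t)$ on $\mathbb{Z}\times\mathbb{N}_0$ with transition probabilities $$\mathbb{P}((X,T)_{t+1}=(z',\tau')\mid (X,T)_t=(z,\tau))=\begin{cases}p(\tau')/2 & \text{if } |z-z'|=1 \text{ and } \tau=0,\\ 1 & \text{if } z=z' \text{ and } \tau'=\tau-1\geq 0,\\ 0&\text{otherwise.}\end{cases}$$ $X_t$ is the position and $T_t$ the remaining trapping time. $\sigma_t^2=\mathbb{E}(X_t^2)$ is the mean squared displacement. *)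

theory Defs
  imports "HOL-Probability.Probability"
begin

definition trw_trans :: "nat pmf \<Rightarrow> int \<times> nat \<Rightarrow> int \<times> nat \<Rightarrow> real" where
  "trw_trans p = (\<lambda>(z, \<tau>) (z', \<tau>').
     if \<bar>z - z'\<bar> = 1 \<and> \<tau> = 0 then pmf p \<tau>' / 2
     else if z = z' \<and> \<tau> = \<tau>' + 1 then 1
     else 0)"

definition trw_init :: "nat pmf \<Rightarrow> int \<times> nat \<Rightarrow> real" where
  "trw_init p = (\<lambda>(z, \<tau>). if z = 0 then pmf p \<tau> else 0)"

(* The Markov property is conditioned on the whole history h 0, ..., h t, whenever that
   history has positive probability. *)
locale trapped_random_walk = prob_space M
  for M :: "'a measure"
    and p :: "nat pmf"
    and X :: "nat \<Rightarrow> 'a \<Rightarrow> int"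
    and T :: "nat \<Rightarrow> 'a \<Rightarrow> nat" +
  assumes measurable_position: "\<And>t. X t \<in> M \<rightarrow>\<^sub>M count_space UNIV"
    and measurable_trapping: "\<And>t. T t \<in> M \<rightarrow>\<^sub>M count_space UNIV"
    and initial: "\<And>s. \<P>(\<omega> in M. (X 0 \<omega>, T 0 \<omega>) = s) = trw_init p s"
    and markov: "\<And>t (h :: nat \<Rightarrow> int \<times> nat) s.
      \<P>(\<omega> in M. \<forall>i\<le>t. (X i \<omega>, T i \<omega>) = h i) > 0 \<Longrightarrow>
      \<P>(\<omega> in M. (X (Suc t) \<omega>, T (Suc t) \<omega>) = s \<bar> \<forall>i\<le>t. (X i \<omega>, T i \<omega>) = h i)
        = trw_trans p (h t) s"

(* For a trapped random walk started at the origin, \<bar>X t\<bar> \<le> t almost surely, so this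
   Bochner integral is the integral of an integrable function. *)
definition mean_squared_displacement :: "'a measure \<Rightarrow> (nat \<Rightarrow> 'a \<Rightarrow> int) \<Rightarrow> nat \<Rightarrow> real" where
  "mean_squared_displacement M X t = (\<integral>\<omega>. (real_of_int (X t \<omega>))\<^sup>2 \<partial>M)"

end

theory Submission
  imports Defs
begin

text \<open>
  Write \<open>u\<^sub>t\<close> for the probability that \<open>T\<^sub>t = 0\<close>. The second moment of the position grows by exactly
  \<open>u\<^sub>t\<close> in step \<open>t\<close>. The truncated trapping time \<open>min T\<^sub>t K\<close> loses at most \<open>1\<close> per step, while at a
  jump its expectation goes from \<open>0\<close> to the truncated mean \<open>m\<^sub>K\<close> of \<open>p\<close>; as it stays below \<open>K\<close>,
  the sum of the first \<open>t\<close> values of \<open>u\<close> times \<open>m\<^sub>K\<close> is at most \<open>K + t\<close>. Hence the limit superior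
  of \<open>\<sigma>\<^sub>t\<^sup>2 / t\<close> is at most \<open>1 / m\<^sub>K\<close>, and \<open>m\<^sub>K\<close> tends to infinity with \<open>K\<close>.
\<close>

section \<open>Integration over the values of a countably valued variable\<close>

lemma nn_integral_countable_valued:
  fixes Y :: "'a \<Rightarrow> 'b::countable"
  assumes [measurable]: "Y \<in> M \<rightarrow>\<^sub>M count_space UNIV"
  shows "(\<integral>\<^sup>+\<omega>. g (Y \<omega>) \<partial>M)
    = (\<integral>\<^sup>+y. g y * emeasure M {\<omega>\<in>space M. Y \<omega> = y} \<partial>count_space UNIV)"
proof -
  \<comment> \<open>\<open>g (Y \<omega>)\<close> is expanded as a sum with one nonzero term, so
    that Tonelli can move the sum over values outside.\<close>
  have "(\<integral>\<^sup>+\<omega>. g (Y \<omega>) \<partial>M)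
      = (\<integral>\<^sup>+\<omega>. (\<integral>\<^sup>+y. g y * indicator {y. Y \<omega> = y} y \<partial>count_space UNIV) \<partial>M)"
    by (intro nn_integral_cong) (simp add: nn_integral_indicator_singleton)
  also have "\<dots> = (\<integral>\<^sup>+\<omega>. (\<integral>\<^sup>+y. g y * indicator {\<omega>\<in>space M. Y \<omega> = y} \<omega> \<partial>count_space UNIV) \<partial>M)"
    by (intro nn_integral_cong) (auto simp: indicator_def)
  also have "\<dots> = (\<integral>\<^sup>+y. (\<integral>\<^sup>+\<omega>. g y * indicator {\<omega>\<in>space M. Y \<omega> = y} \<omega> \<partial>M) \<partial>count_space UNIV)"
    by (rule nn_integral_count_space_nn_integral[OF countableI_type]) measurable
  also have "\<dots> = (\<integral>\<^sup>+y. g y * emeasure M {\<omega>\<in>space M. Y \<omega> = y} \<partial>count_space UNIV)"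
    by (intro nn_integral_cong nn_integral_cmult_indicator) measurable
  finally show ?thesis .
qed

section \<open>The one-step transition law as a \<open>pmf\<close>\<close>

fun trw_step :: "nat pmf \<Rightarrow> int \<times> nat \<Rightarrow> (int \<times> nat) pmf" where
  "trw_step p (z, 0) = pair_pmf (map_pmf (\<lambda>b. if b then z + 1 else z - 1) (bernoulli_pmf (1/2))) p"
| "trw_step p (z, Suc \<tau>) = return_pmf (z, \<tau>)"

lemma pmf_fair_sign:
  "pmf (map_pmf (\<lambda>b. if b then z + 1 else z - 1) (bernoulli_pmf (1/2))) (z'::int)
    = (if \<bar>z - z'\<bar> = 1 then 1/2 else 0)"
proof -
  let ?f = "\<lambda>b. if b then z + 1 else z - 1"
  have inj: "inj ?f"
    by (auto simp: inj_def)
  consider "z' = ?f True" | "z' = ?f False" | "\<bar>z - z'\<bar> \<noteq> 1"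
    by (auto; arith)
  then show ?thesis
  proof cases
    case 3
    then have "z' \<notin> set_pmf (map_pmf ?f (bernoulli_pmf (1/2)))"
      by auto
    then have "pmf (map_pmf ?f (bernoulli_pmf (1/2))) z' = 0"
      by (simp only: pmf_eq_0_set_pmf not_False_eq_True)
    with 3 show ?thesis
      by simp
  next
    case 1
    then show ?thesis using pmf_map_inj'[OF inj, of "bernoulli_pmf (1/2)" True] by simp
  next
    case 2
    then show ?thesis using pmf_map_inj'[OF inj, of "bernoulli_pmf (1/2)" False] by simp
  qed
qed

text \<open>This turns the table of transition probabilities into a family of measures that can be
  integrated against. At a jump, a fair sign and an independent new trapping time give the product
  \<open>p \<tau>' / 2\<close>.\<close>

lemma pmf_trw_step: "pmf (trw_step p s) s' = trw_trans p s s'"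
proof -
  obtain z \<tau> z' \<tau>' where s: "s = (z, \<tau>)" "s' = (z', \<tau>')"
    by (metis surj_pair)
  show ?thesis
  proof (cases \<tau>)
    case 0
    then show ?thesis
      by (simp add: s trw_trans_def pmf_pair pmf_fair_sign)
  next
    case (Suc n)
    then show ?thesis
      by (auto simp: s trw_trans_def indicator_def)
  qed
qed

lemma nn_integral_trw_step_0:
  "(\<integral>\<^sup>+s. g (fst s) \<partial>trw_step p (z, 0)) = (g (z + 1) + g (z - 1)) / 2"
  "(\<integral>\<^sup>+s. k (snd s) \<partial>trw_step p (z, 0)) = (\<integral>\<^sup>+\<tau>. k \<tau> \<partial>p)"
  by (simp_all add: nn_integral_pair_pmf' divide_ennreal_def distrib_right)

section \<open>Histories and averaging over the next step\<close>

context trapped_random_walk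
begin

definition state :: "nat \<Rightarrow> 'a \<Rightarrow> int \<times> nat" where
  "state t \<omega> = (X t \<omega>, T t \<omega>)"

text \<open>Finite lists form a countable type, which functions on \<open>nat\<close> do not, so
  integrals can be split into sums over all possible histories.\<close>

definition history :: "nat \<Rightarrow> 'a \<Rightarrow> (int \<times> nat) list" where
  "history t \<omega> = map (\<lambda>i. state i \<omega>) [0..<Suc t]"

lemma history_eq_iff:
  "history t \<omega> = l \<longleftrightarrow> length l = Suc t \<and> (\<forall>i\<le>t. state i \<omega> = l ! i)"
  unfolding history_def list_eq_iff_nth_eq by (auto simp: less_Suc_eq_le simp del: upt_Suc)

lemma last_history: "last (history t \<omega>) = state t \<omega>"
  by (simp add: history_def)

lemma measurable_state [measurable]: "state t \<in> M \<rightarrow>\<^sub>M count_space UNIV"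
proof -
  note [measurable] = measurable_position measurable_trapping
  have "{\<omega>\<in>space M. X t \<omega> = z \<and> T t \<omega> = \<tau>} \<in> sets M" for z \<tau>
    by measurable
  moreover have "state t -` {(z, \<tau>)} \<inter> space M = {\<omega>\<in>space M. X t \<omega> = z \<and> T t \<omega> = \<tau>}" for z \<tau>
    by (auto simp: state_def)
  ultimately show ?thesis
    by (subst measurable_count_space_eq2_countable) auto
qed

lemma measurable_history [measurable]: "history t \<in> M \<rightarrow>\<^sub>M count_space UNIV"
proof -
  have "{\<omega>\<in>space M. length l = Suc t \<and> (\<forall>i\<le>t. state i \<omega> = l ! i)} \<in> sets M" for l
    by measurable
  moreover have "history t -` {l} \<inter> space M
      = {\<omega>\<in>space M. length l = Suc t \<and> (\<forall>i\<le>t. state i \<omega> = l ! i)}" for l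
    using history_eq_iff[of t _ l] by auto
  ultimately show ?thesis
    by (subst measurable_count_space_eq2_countable) auto
qed

text \<open>The Markov assumption multiplied out. In this form null histories are covered as well,
  both sides then being 0, and one may sum over all \<open>l\<close>.\<close>

lemma prob_history_Suc:
  "prob {\<omega>\<in>space M. history t \<omega> = l \<and> state (Suc t) \<omega> = s}
    = prob {\<omega>\<in>space M. history t \<omega> = l} * pmf (trw_step p (last l)) s"
proof (cases "prob {\<omega>\<in>space M. history t \<omega> = l} > 0")
  case False
  then have "prob {\<omega>\<in>space M. history t \<omega> = l} = 0"
    by (simp add: zero_less_measure_iff)
  moreover have "prob {\<omega>\<in>space M. history t \<omega> = l \<and> state (Suc t) \<omega> = s}
      \<le> prob {\<omega>\<in>space M. history t \<omega> = l}"
    by (intro finite_measure_mono) auto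
  ultimately show ?thesis
    by (simp add: measure_le_0_iff)
next
  case True
  \<comment> \<open>Positive probability makes the event nonempty, which forces the right length and
    identifies \<open>last l\<close> with the state at time \<open>t\<close>.\<close>
  then have "{\<omega>\<in>space M. history t \<omega> = l} \<noteq> {}"
    by (metis measure_empty less_irrefl)
  then have len: "length l = Suc t"
    using history_eq_iff[of t _ l] by auto
  then have last: "last l = l ! t"
    by (metis diff_Suc_1 last_conv_nth list.size(3) nat.simps(3))
  have ev: "history t \<omega> = l \<longleftrightarrow> (\<forall>i\<le>t. (X i \<omega>, T i \<omega>) = l ! i)" for \<omega>
    using len by (simp add: history_eq_iff state_def)
  show ?thesis
    using markov[of t "\<lambda>i. l ! i" s] True
    by (simp add: ev state_def[of "Suc t"] cond_prob_def pmf_trw_step last conj_commute field_simps)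
qed

text \<open>The assumption conditions on the whole past, so the integral is first split over pairs
  of history and next state. The inner sum depends on the history only through its last entry, and
  summing back over histories leaves the state at time \<open>t\<close>.\<close>

lemma nn_integral_state_Suc:
  fixes g :: "int \<times> nat \<Rightarrow> ennreal"
  shows "(\<integral>\<^sup>+\<omega>. g (state (Suc t) \<omega>) \<partial>M) = (\<integral>\<^sup>+\<omega>. (\<integral>\<^sup>+s. g s \<partial>trw_step p (state t \<omega>)) \<partial>M)"
proof -
  have ev: "{\<omega>\<in>space M. (history t \<omega>, state (Suc t) \<omega>) = (l, s)}
      = {\<omega>\<in>space M. history t \<omega> = l \<and> state (Suc t) \<omega> = s}" for l s
    by auto
  have [measurable]: "(\<lambda>\<omega>. (history t \<omega>, state (Suc t) \<omega>)) \<in> M \<rightarrow>\<^sub>M count_space UNIV"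
  proof -
    have "{\<omega>\<in>space M. history t \<omega> = l \<and> state (Suc t) \<omega> = s} \<in> sets M" for l s
      by measurable
    moreover have "(\<lambda>\<omega>. (history t \<omega>, state (Suc t) \<omega>)) -` {(l, s)} \<inter> space M
      = {\<omega>\<in>space M. history t \<omega> = l \<and> state (Suc t) \<omega> = s}" for l s
      by auto
    ultimately show ?thesis
      by (subst measurable_count_space_eq2_countable) auto
  qed
  have "(\<integral>\<^sup>+\<omega>. g (state (Suc t) \<omega>) \<partial>M)
      = (\<integral>\<^sup>+\<omega>. (\<lambda>(l, s). g s) (history t \<omega>, state (Suc t) \<omega>) \<partial>M)"
    by simp
  also have "\<dots> = (\<integral>\<^sup>+y. (\<lambda>(l, s). g s) y *
      emeasure M {\<omega>\<in>space M. (history t \<omega>, state (Suc t) \<omega>) = y} \<partial>count_space UNIV)"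
    by (rule nn_integral_countable_valued) measurable
  also have "\<dots> = (\<integral>\<^sup>+l. \<integral>\<^sup>+s. g s *
      emeasure M {\<omega>\<in>space M. history t \<omega> = l \<and> state (Suc t) \<omega> = s}
      \<partial>count_space UNIV \<partial>count_space UNIV)"
    by (subst nn_integral_fst_count_space[symmetric]) (simp add: ev del: prod.inject)
  also have "\<dots> = (\<integral>\<^sup>+l. \<integral>\<^sup>+s. emeasure M {\<omega>\<in>space M. history t \<omega> = l} *
      (ennreal (pmf (trw_step p (last l)) s) * g s) \<partial>count_space UNIV \<partial>count_space UNIV)"
    by (intro nn_integral_cong)
      (simp add: emeasure_eq_measure prob_history_Suc ennreal_mult mult_ac)
  also have "\<dots> = (\<integral>\<^sup>+l. (\<integral>\<^sup>+s. g s \<partial>trw_step p (last l)) *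
      emeasure M {\<omega>\<in>space M. history t \<omega> = l} \<partial>count_space UNIV)"
    by (subst nn_integral_cmult) (auto simp: nn_integral_measure_pmf mult.commute)
  also have "\<dots> = (\<integral>\<^sup>+\<omega>. (\<integral>\<^sup>+s. g s \<partial>trw_step p (last (history t \<omega>))) \<partial>M)"
    by (rule nn_integral_countable_valued[symmetric]) measurable
  finally show ?thesis
    by (simp add: last_history)
qed

section \<open>Evolution of the second moment and of the truncated trapping time\<close>

lemma second_moment_0:
  "(\<integral>\<^sup>+\<omega>. ennreal ((real_of_int (fst (state 0 \<omega>)))\<^sup>2) \<partial>M) = 0"
proof -
  have "emeasure M {\<omega>\<in>space M. state 0 \<omega> = s} = ennreal (trw_init p s)" for s
    using initial[of s] by (simp add: emeasure_eq_measure state_def)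
  then show ?thesis
    by (subst nn_integral_countable_valued[where g = "\<lambda>s. ennreal ((real_of_int (fst s))\<^sup>2)"])
      (auto intro!: nn_integral_zero' simp: trw_init_def split: prod.splits)
qed

text \<open>A jump from \<open>z\<close> averages \<open>(z + 1)^2\<close> and
  \<open>(z - 1)^2\<close> to \<open>z^2 + 1\<close>, while a trapped walker does not move.\<close>

lemma second_moment_Suc:
  "(\<integral>\<^sup>+\<omega>. ennreal ((real_of_int (fst (state (Suc t) \<omega>)))\<^sup>2) \<partial>M)
    = (\<integral>\<^sup>+\<omega>. ennreal ((real_of_int (fst (state t \<omega>)))\<^sup>2) \<partial>M) + emeasure M {\<omega>\<in>space M. T t \<omega> = 0}"
proof -
  note [measurable] = measurable_trapping
  have step: "(\<integral>\<^sup>+s. ennreal ((real_of_int (fst s))\<^sup>2) \<partial>trw_step p (state t \<omega>))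
      = ennreal ((real_of_int (fst (state t \<omega>)))\<^sup>2) + indicator {\<omega>\<in>space M. T t \<omega> = 0} \<omega>"
    if "\<omega> \<in> space M" for \<omega>
  proof (cases "T t \<omega>")
    case 0
    have "(ennreal ((real_of_int (z + 1))\<^sup>2) + ennreal ((real_of_int (z - 1))\<^sup>2)) / 2
        = ennreal ((real_of_int z)\<^sup>2) + 1" for z
    proof -
      have "(ennreal ((real_of_int (z + 1))\<^sup>2) + ennreal ((real_of_int (z - 1))\<^sup>2)) / 2
          = ennreal (((real_of_int (z + 1))\<^sup>2 + (real_of_int (z - 1))\<^sup>2) / 2)"
        by (subst divide_ennreal[symmetric]) (auto simp: ennreal_plus)
      also have "((real_of_int (z + 1))\<^sup>2 + (real_of_int (z - 1))\<^sup>2) / 2 = (real_of_int z)\<^sup>2 + 1"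
        by (simp add: power2_eq_square algebra_simps)
      finally show ?thesis
        by (simp add: ennreal_plus)
    qed
    then show ?thesis
      using 0 that
        nn_integral_trw_step_0(1)[where g = "\<lambda>z. ennreal ((real_of_int z)\<^sup>2)" and z = "X t \<omega>"]
      by (simp add: state_def)
  next
    case (Suc n)
    then show ?thesis
      by (simp add: state_def)
  qed
  have "(\<integral>\<^sup>+\<omega>. ennreal ((real_of_int (fst (state (Suc t) \<omega>)))\<^sup>2) \<partial>M)
      = (\<integral>\<^sup>+\<omega>. ennreal ((real_of_int (fst (state t \<omega>)))\<^sup>2) + indicator {\<omega>\<in>space M. T t \<omega> = 0} \<omega> \<partial>M)"
    unfolding nn_integral_state_Suc[of "\<lambda>s. ennreal ((real_of_int (fst s))\<^sup>2)"]
    by (intro nn_integral_cong step)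
  then show ?thesis
    by (simp add: nn_integral_add)
qed

text \<open>The inequality holds pointwise before integrating: a trapped state loses at most 1, and
  a state with \<open>T t \<omega> = 0\<close> is renewed with mean \<open>?m\<close>. The loss is
  added on the right because subtraction in \<open>ennreal\<close> is truncated.\<close>

lemma truncated_trapping_time_Suc:
  "(\<integral>\<^sup>+\<omega>. of_nat (min (T t \<omega>) K) \<partial>M)
      + (\<integral>\<^sup>+\<tau>. of_nat (min \<tau> K) \<partial>p) * emeasure M {\<omega>\<in>space M. T t \<omega> = 0}
    \<le> (\<integral>\<^sup>+\<omega>. of_nat (min (T (Suc t) \<omega>) K) \<partial>M) + 1"
proof -
  note [measurable] = measurable_trapping
  let ?m = "\<integral>\<^sup>+\<tau>. of_nat (min \<tau> K) \<partial>p"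
  have step: "of_nat (min (T t \<omega>) K) + ?m * indicator {\<omega>\<in>space M. T t \<omega> = 0} \<omega>
      \<le> (\<integral>\<^sup>+s. of_nat (min (snd s) K) \<partial>trw_step p (state t \<omega>)) + 1" for \<omega>
  proof (cases "T t \<omega>")
    case 0
    then show ?thesis
      using nn_integral_trw_step_0(2)[where k = "\<lambda>\<tau>. of_nat (min \<tau> K)" and z = "X t \<omega>" and p = p]
      by (auto simp: state_def indicator_def)
  next
    case (Suc n)
    have "of_nat (min (Suc n) K) \<le> (of_nat (min n K + 1) :: ennreal)"
      by (intro of_nat_mono) auto
    with Suc show ?thesis
      by (simp add: state_def add.commute)
  qed
  have "(\<integral>\<^sup>+\<omega>. of_nat (min (T t \<omega>) K) \<partial>M) + ?m * emeasure M {\<omega>\<in>space M. T t \<omega> = 0}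
      = (\<integral>\<^sup>+\<omega>. of_nat (min (T t \<omega>) K) + ?m * indicator {\<omega>\<in>space M. T t \<omega> = 0} \<omega> \<partial>M)"
    by (simp add: nn_integral_add nn_integral_cmult_indicator)
  also have "\<dots> \<le> (\<integral>\<^sup>+\<omega>. (\<integral>\<^sup>+s. of_nat (min (snd s) K) \<partial>trw_step p (state t \<omega>)) + 1 \<partial>M)"
    by (intro nn_integral_mono step)
  also have "\<dots> = (\<integral>\<^sup>+\<omega>. (\<integral>\<^sup>+s. of_nat (min (snd s) K) \<partial>trw_step p (state t \<omega>)) \<partial>M) + 1"
    by (subst nn_integral_add) (auto simp: emeasure_space_1)
  also have "\<dots> = (\<integral>\<^sup>+\<omega>. of_nat (min (T (Suc t) \<omega>) K) \<partial>M) + 1"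
    unfolding nn_integral_state_Suc[of "\<lambda>s. of_nat (min (snd s) K)", symmetric]
    by (simp add: state_def)
  finally show ?thesis .
qed

lemma truncated_mean_mult_second_moment_le:
  "(\<integral>\<^sup>+\<tau>. of_nat (min \<tau> K) \<partial>p) * (\<integral>\<^sup>+\<omega>. ennreal ((real_of_int (X t \<omega>))\<^sup>2) \<partial>M) \<le> of_nat (K + t)"
proof -
  let ?m = "\<integral>\<^sup>+\<tau>. of_nat (min \<tau> K) \<partial>p"
  let ?A = "\<lambda>t. \<integral>\<^sup>+\<omega>. ennreal ((real_of_int (fst (state t \<omega>)))\<^sup>2) \<partial>M"
  let ?B = "\<lambda>t. \<integral>\<^sup>+\<omega>. of_nat (min (T t \<omega>) K) \<partial>M :: ennreal"
  \<comment> \<open>By \<open>second_moment_Suc\<close>, \<open>?A t\<close> already is the sum of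
    the jump probabilities before time \<open>t\<close>, so the drift inequality telescopes directly
    with \<open>?A\<close>.\<close>
  have "?m * ?A t \<le> ?B t + of_nat t"
  proof (induction t)
    case 0
    then show ?case
      by (simp add: second_moment_0)
  next
    case (Suc t)
    have "?m * ?A (Suc t) = ?m * ?A t + ?m * emeasure M {\<omega>\<in>space M. T t \<omega> = 0}"
      by (simp only: second_moment_Suc distrib_left)
    also have "\<dots> \<le> (?B t + of_nat t) + ?m * emeasure M {\<omega>\<in>space M. T t \<omega> = 0}"
      by (intro add_right_mono Suc)
    also have "\<dots> = (?B t + ?m * emeasure M {\<omega>\<in>space M. T t \<omega> = 0}) + of_nat t"
      by (simp only: add_ac)
    also have "\<dots> \<le> (?B (Suc t) + 1) + of_nat t"
      by (intro add_right_mono truncated_trapping_time_Suc)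
    finally show ?case
      by (simp add: add_ac)
  qed
  also have "?B t \<le> (\<integral>\<^sup>+\<omega>. of_nat K \<partial>M)"
    by (intro nn_integral_mono of_nat_mono) auto
  finally show ?thesis
    by (simp add: state_def emeasure_space_1 add_right_mono)
qed

end

section \<open>Infinite mean and the limit\<close>

lemma SUP_truncated_mean:
  fixes p :: "nat pmf"
  assumes "(\<Sum>\<tau>. ennreal (real \<tau> * pmf p \<tau>)) = \<infinity>"
  shows "(SUP K. \<integral>\<^sup>+\<tau>. of_nat (min \<tau> K) \<partial>p) = (\<infinity> :: ennreal)"
proof -
  have "(SUP K. \<integral>\<^sup>+\<tau>. of_nat (min \<tau> K) \<partial>p) = (\<integral>\<^sup>+\<tau>. (SUP K. of_nat (min \<tau> K) :: ennreal) \<partial>p)"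
    by (rule nn_integral_monotone_convergence_SUP[symmetric])
      (auto simp: incseq_def le_fun_def intro!: of_nat_mono)
  \<comment> \<open>The supremum is attained as soon as \<open>K\<close> reaches
    \<open>\<tau>\<close>.\<close>
  also have "(\<lambda>\<tau>. SUP K. of_nat (min \<tau> K)) = (of_nat :: nat \<Rightarrow> ennreal)"
    by (intro ext antisym SUP_least) (auto intro!: of_nat_mono SUP_upper2)
  also have "(\<integral>\<^sup>+\<tau>. of_nat \<tau> \<partial>p) = (\<Sum>\<tau>. ennreal (real \<tau> * pmf p \<tau>))"
    by (simp add: nn_integral_measure_pmf nn_integral_count_space_nat ennreal_mult
        ennreal_of_nat_eq_real_of_nat mult.commute)
  finally show ?thesis
    using assms by simp
qed

theorem proposition3:
  fixes M :: "'a measure" and p :: "nat pmf"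
    and X :: "nat \<Rightarrow> 'a \<Rightarrow> int" and T :: "nat \<Rightarrow> 'a \<Rightarrow> nat"
  assumes "trapped_random_walk M p X T"
    and "(\<Sum>\<tau>. ennreal (real \<tau> * pmf p \<tau>)) = \<infinity>"
  shows "(\<lambda>t. mean_squared_displacement M X t / real t) \<longlonglongrightarrow> 0"
proof (rule LIMSEQ_I)
  interpret trapped_random_walk M p X T by fact
  note [measurable] = measurable_position
  fix e :: real
  assume e: "e > 0"
  \<comment> \<open>A truncated mean above \<open>2 / e\<close> bounds the displacement by
    \<open>e / 2 * (K + t)\<close>; the factor 2 absorbs \<open>K\<close> once
    \<open>t > K\<close>.\<close>
  have "ennreal (2 / e) < (SUP K. \<integral>\<^sup>+\<tau>. of_nat (min \<tau> K) \<partial>p)"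
    using assms(2) by (simp add: SUP_truncated_mean)
  then obtain K where K: "ennreal (2 / e) < (\<integral>\<^sup>+\<tau>. of_nat (min \<tau> K) \<partial>p)"
    by (auto simp: less_SUP_iff)
  have bound: "mean_squared_displacement M X t \<le> e / 2 * real (K + t)" for t
  proof -
    let ?A = "\<integral>\<^sup>+\<omega>. ennreal ((real_of_int (X t \<omega>))\<^sup>2) \<partial>M"
    have "ennreal (2 / e) * ?A \<le> (\<integral>\<^sup>+\<tau>. of_nat (min \<tau> K) \<partial>p) * ?A"
      using K by (intro mult_right_mono) auto
    also have "\<dots> \<le> of_nat (K + t)"
      by (rule truncated_mean_mult_second_moment_le)
    \<comment> \<open>\<open>enn2real\<close> sends infinity to 0, so monotonicity relies on the
      right-hand side being finite.\<close>
    finally have "enn2real (ennreal (2 / e) * ?A) \<le> enn2real (of_nat (K + t))"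
      by (intro enn2real_mono) (auto simp: ennreal_of_nat_eq_real_of_nat)
    then have "2 / e * enn2real ?A \<le> real (K + t)"
      using e by (simp add: enn2real_mult ennreal_of_nat_eq_real_of_nat del: of_nat_add)
    \<comment> \<open>Measurability and nonnegativity suffice here: without integrability both sides
      would be 0.\<close>
    moreover have "mean_squared_displacement M X t = enn2real ?A"
      unfolding mean_squared_displacement_def by (intro integral_eq_nn_integral) auto
    ultimately show ?thesis
      using e by (simp add: field_simps)
  qed
  show "\<exists>t0. \<forall>t\<ge>t0. norm (mean_squared_displacement M X t / real t - 0) < e"
  proof (intro exI allI impI)
    fix t
    \<comment> \<open>This gives both \<open>K + t < 2 * t\<close> and \<open>t > 0\<close>, the
      latter for the division.\<close>
    assume t: "t \<ge> Suc K"
    have "mean_squared_displacement M X t \<ge> 0"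
      unfolding mean_squared_displacement_def by simp
    moreover have "e / 2 * real (K + t) < e / 2 * (2 * real t)"
      using t e by (intro mult_strict_left_mono) auto
    ultimately show "norm (mean_squared_displacement M X t / real t - 0) < e"
      using bound[of t] t by (simp add: divide_less_eq)
  qed
qed

end
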